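(* Let $K$ be a loop-free unital free augmented directed complex. (1) If $x=(\,x_0^-,x_0^+\mid x_1^-,x_1^+\mid\ldots\,)$ is a member of $\nu K$, then $x_0^-$ and $x_0^+$ are basis elements. (2) If $x=(\,x_0^-,x_0^+\mid x_1^-,x_1^+\mid\ldots\,)$ is a member of $\nu K$, if $q\geq 0$, and if $c$ is $x_q^-$, $x_q^+$, $g_q^-(x)$ or $g_q^+(x)$, then $c$ is a sum of distinct basis elements.
   Context: A *free augmented directed complex* $K$ is an augmented chain complex of free abelian groups $K_q$, $q\geq 0$ (boundary $\partial\colon K_{q+1}\to K_q$ with $\partial\partial=0$, $\partial=0$ on $K_0$, augmentation $\epsilon\colon K_0\to\mathbb{Z}$ with $\epsilon\partial=0$), together with a distinguished basis for each $K_q$. Members of the basis of $K_q$ are the $q$-dimensional basis elements. A "sum of basis elements" is a (possibly empty, possibly with repetitions) finite sum of basis elements, i.e. a linear combination with nonnegative integer coefficients; its terms are the basis elements occurring in it; a "sum of distinct basis elements" is one in which all coefficients are $0$ or $1$. For a chain $c$ write $\partial c=\partial^+c-\partial^-c$ where $\partial^+c,\partial^-c$ are sums of basis elements with no common terms; $(\partial^\pm)^r$ denotes the $r$-fold iterate of $\partial^\pm$. $K$ is *unital* if $\epsilon(\partial^-)^q a=\epsilon(\partial^+)^q a=1$ for each basis element $a$ of dimension $q$. $K$ is *loop-free* if its basis elements can be partially ordered so that, for any basis element $a$ and any integer $r>0$, the basis elements which are terms in $(\partial^-)^r a$ (strictly) precede those which are terms in $(\partial^+)^r a$. The members of $\nu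 K$ are the double sequences $(\,x_0^-,x_0^+\mid x_1^-,x_1^+\mid\ldots\,)$ such that $x_q^-$ and $x_q^+$ are sums of $q$-dimensional basis elements, finitely many terms of the double sequence are non-zero, $\epsilon x_0^-=\epsilon x_0^+=1$, and $\partial x_q^-=\partial x_q^+=x_{q-1}^+-x_{q-1}^-$ for $q>0$. For $x\in\nu K$, $q\geq 0$ and a sign $\alpha$, write $x_{q+1}^\alpha=a_1+\ldots+a_k$ as a sum of basis elements; then $g_q^\alpha(x)$ is the $q$-chain $$g_q^\alpha(x)=x_q^-+\partial^+a_1+\ldots+\partial^+a_k=\partial^-a_1+\ldots+\partial^-a_k+x_q^+$$ (the two expressions are equal because $\partial x_{q+1}^\alpha=x_q^+-x_q^-$). *)

theory Defs
  imports "HOL-Algebra.Free_Abelian_Groups"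
begin

text \<open>
  The chain group in dimension \<open>q\<close> is \<^term>\<open>free_Abelian_group (basis K q)\<close>, and a basis element
  \<open>a\<close> is identified, as a chain, with \<^term>\<open>frag_of a\<close>. The sets \<^term>\<open>basis K q\<close> need not be
  disjoint for distinct \<open>q\<close>, so a basis element of the whole complex is a pair \<open>(q, a)\<close> with
  \<open>a \<in> basis K q\<close>. The map \<open>bd K q\<close> is the boundary out of dimension \<open>q\<close>, with values in dimension
  \<open>q - 1\<close>; \<open>bd K 0\<close> is the zero map on 0-chains.
\<close>

record 'a adc =
  basis :: "nat \<Rightarrow> 'a set"
  bd :: "nat \<Rightarrow> ('a \<Rightarrow>\<^sub>0 int) \<Rightarrow> ('a \<Rightarrow>\<^sub>0 int)"
  aug :: "('a \<Rightarrow>\<^sub>0 int) \<Rightarrow> int"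

abbreviation chain_group :: "'a adc \<Rightarrow> nat \<Rightarrow> ('a \<Rightarrow>\<^sub>0 int) monoid"
  where "chain_group K q \<equiv> free_Abelian_group (basis K q)"

locale free_adc =
  fixes K :: "'a adc"
  assumes bd_hom: "bd K (Suc q) \<in> hom (chain_group K (Suc q)) (chain_group K q)"
    and bd_0: "c \<in> carrier (chain_group K 0) \<Longrightarrow> bd K 0 c = 0"
    and bd_bd: "c \<in> carrier (chain_group K (Suc (Suc q))) \<Longrightarrow> bd K (Suc q) (bd K (Suc (Suc q)) c) = 0"
    and aug_hom: "aug K \<in> hom (chain_group K 0) integer_group"
    and aug_bd: "c \<in> carrier (chain_group K 1) \<Longrightarrow> aug K (bd K 1 c) = 0"

definition sum_of_basis :: "'a adc \<Rightarrow> nat \<Rightarrow> ('a \<Rightarrow>\<^sub>0 int) \<Rightarrow> bool"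
  where "sum_of_basis K q c \<longleftrightarrow>
    c \<in> carrier (chain_group K q) \<and> (\<forall>a. 0 \<le> Poly_Mapping.lookup c a)"

definition sum_of_distinct_basis :: "'a adc \<Rightarrow> nat \<Rightarrow> ('a \<Rightarrow>\<^sub>0 int) \<Rightarrow> bool"
  where "sum_of_distinct_basis K q c \<longleftrightarrow>
    c \<in> carrier (chain_group K q) \<and> (\<forall>a. Poly_Mapping.lookup c a \<in> {0, 1})"

datatype sign = Neg | Pos

text \<open>The decomposition \<open>c = part Pos c - part Neg c\<close>; see \<open>part_unique\<close> below.\<close>

fun part :: "sign \<Rightarrow> ('a \<Rightarrow>\<^sub>0 int) \<Rightarrow> ('a \<Rightarrow>\<^sub>0 int)"
  where "part Pos c = Poly_Mapping.map (\<lambda>n. max n 0) c"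
  | "part Neg c = Poly_Mapping.map (\<lambda>n. max (- n) 0) c"

definition bdp :: "'a adc \<Rightarrow> sign \<Rightarrow> nat \<Rightarrow> ('a \<Rightarrow>\<^sub>0 int) \<Rightarrow> ('a \<Rightarrow>\<^sub>0 int)"
  where "bdp K \<alpha> q c = part \<alpha> (bd K q c)"

text \<open>
  \<open>bdp_iter K \<alpha> r q c\<close> applies the signed boundary \<open>r\<close> times to a \<open>q\<close>-chain \<open>c\<close>, with a result in
  dimension \<open>q - r\<close>. For \<open>r > q\<close> the truncated subtraction gives \<open>q - r = 0\<close>; the result is then
  the zero chain, because \<open>bd K 0\<close> is zero.
\<close>

fun bdp_iter :: "'a adc \<Rightarrow> sign \<Rightarrow> nat \<Rightarrow> nat \<Rightarrow> ('a \<Rightarrow>\<^sub>0 int) \<Rightarrow> ('a \<Rightarrow>\<^sub>0 int)"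
  where "bdp_iter K \<alpha> 0 q c = c"
  | "bdp_iter K \<alpha> (Suc r) q c = bdp K \<alpha> (q - r) (bdp_iter K \<alpha> r q c)"

definition unital :: "'a adc \<Rightarrow> bool"
  where "unital K \<longleftrightarrow>
    (\<forall>q. \<forall>a \<in> basis K q. \<forall>\<alpha>. aug K (bdp_iter K \<alpha> q q (frag_of a)) = 1)"

definition loop_free :: "'a adc \<Rightarrow> bool"
  where "loop_free K \<longleftrightarrow>
    (\<exists>R. partial_order_on (SIGMA q:UNIV. basis K q) R \<and>
      (\<forall>q. \<forall>a \<in> basis K q. \<forall>r > 0.
        \<forall>b \<in> Poly_Mapping.keys (bdp_iter K Neg r q (frag_of a)).
        \<forall>c \<in> Poly_Mapping.keys (bdp_iter K Pos r q (frag_of a)).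
          ((q - r, b), (q - r, c)) \<in> R \<and> b \<noteq> c))"

definition nu :: "'a adc \<Rightarrow> (nat \<Rightarrow> sign \<Rightarrow> ('a \<Rightarrow>\<^sub>0 int)) set"
  where "nu K = {x.
    (\<forall>q \<alpha>. sum_of_basis K q (x q \<alpha>)) \<and>
    finite {(q, \<alpha>). x q \<alpha> \<noteq> 0} \<and>
    (\<forall>\<alpha>. aug K (x 0 \<alpha>) = 1) \<and>
    (\<forall>q > 0. \<forall>\<alpha>. bd K q (x q \<alpha>) = x (q - 1) Pos - x (q - 1) Neg)}"

text \<open>
  \<^const>\<open>frag_extend\<close> sums over the terms of \<open>x (Suc q) \<alpha>\<close> with multiplicity. The second expression
  for the same chain is \<open>gchain_alt\<close> below.
\<close>

definition gchain :: "'a adc \<Rightarrow> sign \<Rightarrow> nat \<Rightarrow> (nat \<Rightarrow> sign \<Rightarrow> ('a \<Rightarrow>\<^sub>0 int)) \<Rightarrow> ('a \<Rightarrow>\<^sub>0 int)"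
  where "gchain K \<alpha> q x =
    x q Neg + frag_extend (\<lambda>a. bdp K Pos (Suc q) (frag_of a)) (x (Suc q) \<alpha>)"

lemma lookup_part:
  "Poly_Mapping.lookup (part \<alpha> c) a =
    (case \<alpha> of Pos \<Rightarrow> max (Poly_Mapping.lookup c a) 0 | Neg \<Rightarrow> max (- Poly_Mapping.lookup c a) 0)"
  by (cases \<alpha>) (auto simp: map.rep_eq when_def)

lemma part_diff: "part Pos c - part Neg c = c"
  by (rule poly_mapping_eqI) (auto simp: lookup_minus lookup_part max_def simp del: part.simps)

lemma part_unique:
  fixes c p n :: "'a \<Rightarrow>\<^sub>0 int"
  shows "(p = part Pos c \<and> n = part Neg c) \<longleftrightarrow>
    (\<forall>a. 0 \<le> Poly_Mapping.lookup p a) \<and> (\<forall>a. 0 \<le> Poly_Mapping.lookup n a) \<and>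
    Poly_Mapping.keys p \<inter> Poly_Mapping.keys n = {} \<and> c = p - n" (is "?L \<longleftrightarrow> ?R")
proof
  assume L: ?L
  have "Poly_Mapping.keys p \<inter> Poly_Mapping.keys n = {}"
    using L by (auto simp: in_keys_iff lookup_part max_def simp del: part.simps split: if_splits)
  then show ?R
    using L by (auto simp: part_diff lookup_part simp del: part.simps)
next
  assume R: ?R
  have "Poly_Mapping.lookup p a = Poly_Mapping.lookup (part Pos c) a \<and>
        Poly_Mapping.lookup n a = Poly_Mapping.lookup (part Neg c) a" for a
  proof -
    have "Poly_Mapping.lookup p a = 0 \<or> Poly_Mapping.lookup n a = 0"
      using R by (metis disjoint_iff in_keys_iff)
    moreover have "0 \<le> Poly_Mapping.lookup p a" "0 \<le> Poly_Mapping.lookup n a"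
      using R by auto
    moreover have "Poly_Mapping.lookup c a = Poly_Mapping.lookup p a - Poly_Mapping.lookup n a"
      using R by (simp add: lookup_minus)
    ultimately show ?thesis by (auto simp: lookup_part simp del: part.simps)
  qed
  then show ?L by (auto intro: poly_mapping_eqI)
qed

context free_adc
begin

lemma bd_diff:
  assumes "a \<in> carrier (chain_group K (Suc q))" "b \<in> carrier (chain_group K (Suc q))"
  shows "bd K (Suc q) (a - b) = bd K (Suc q) a - bd K (Suc q) b"
proof -
  have "a - b \<in> carrier (chain_group K (Suc q))"
    using assms keys_diff[of a b] by auto
  then have "bd K (Suc q) ((a - b) + b) = bd K (Suc q) (a - b) + bd K (Suc q) b"
    using hom_mult[OF bd_hom[of q], of "a - b" b] assms by simp
  then show ?thesis by (simp add: algebra_simps)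
qed

lemma bd_eq_frag_extend:
  assumes "c \<in> carrier (chain_group K (Suc q))"
  shows "bd K (Suc q) c = frag_extend (\<lambda>a. bd K (Suc q) (frag_of a)) c"
proof -
  have "Poly_Mapping.keys c \<subseteq> basis K (Suc q)" using assms by simp
  then show ?thesis
  proof (rule free_Abelian_group_induct)
    show "bd K (Suc q) 0 = frag_extend (\<lambda>a. bd K (Suc q) (frag_of a)) 0"
      using bd_diff[of 0 q 0] by simp
  next
    fix x y
    assume "Poly_Mapping.keys x \<subseteq> basis K (Suc q)" "Poly_Mapping.keys y \<subseteq> basis K (Suc q)"
      "bd K (Suc q) x = frag_extend (\<lambda>a. bd K (Suc q) (frag_of a)) x"
      "bd K (Suc q) y = frag_extend (\<lambda>a. bd K (Suc q) (frag_of a)) y"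
    then show "bd K (Suc q) (x - y) = frag_extend (\<lambda>a. bd K (Suc q) (frag_of a)) (x - y)"
      using bd_diff[of x q y] by (simp add: frag_extend_diff)
  qed simp
qed

lemma gchain_alt:
  assumes "x \<in> nu K"
  shows "gchain K \<alpha> q x =
    frag_extend (\<lambda>a. bdp K Neg (Suc q) (frag_of a)) (x (Suc q) \<alpha>) + x q Pos"
proof -
  let ?c = "x (Suc q) \<alpha>"
  have c: "?c \<in> carrier (chain_group K (Suc q))"
    and b: "bd K (Suc q) ?c = x q Pos - x q Neg"
    using assms by (force simp: nu_def sum_of_basis_def)+
  have "bd K (Suc q) ?c = frag_extend (\<lambda>a. bdp K Pos (Suc q) (frag_of a) - bdp K Neg (Suc q) (frag_of a)) ?c"
    using bd_eq_frag_extend[OF c] by (simp add: bdp_def part_diff del: part.simps)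
  also have "\<dots> = frag_extend (\<lambda>a. bdp K Pos (Suc q) (frag_of a)) ?c
      - frag_extend (\<lambda>a. bdp K Neg (Suc q) (frag_of a)) ?c"
    by (simp add: frag_extend_def sum_subtractf[symmetric])
      (rule sum.cong, auto intro!: poly_mapping_eqI simp: lookup_add lookup_minus algebra_simps)
  finally show ?thesis
    using b by (simp add: gchain_def algebra_simps)
qed

end

end

theory Submission
  imports Defs
begin

text \<open>
  The chains \<open>x\<^sub>q\<^sup>\<alpha>\<close> are shown to be sums of distinct basis elements by induction on \<open>q\<close>, with
  \<open>g\<^sub>q\<close> as an intermediate step. By loop-freeness the terms of \<open>x\<^sub>q\<^sub>+\<^sub>1\<close> can be enumerated as
  \<open>a\<^sub>1, \<dots>, a\<^sub>k\<close> so that \<open>\<partial>\<^sup>- a\<^sub>i\<close> shares no terms with \<open>\<partial>\<^sup>+ a\<^sub>j\<close> for \<open>j \<ge> i\<close>. Then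
  \<open>\<partial>\<^sup>- a\<^sub>1 \<le> x\<^sub>q\<^sup>-\<close>, and replacing \<open>x\<^sub>q\<^sup>-\<close> by \<open>x\<^sub>q\<^sup>- - \<partial>\<^sup>- a\<^sub>1 + \<partial>\<^sup>+ a\<^sub>1\<close> and dropping \<open>a\<^sub>1\<close> gives a shorter
  member of \<open>\<nu>K\<close>; its \<open>g\<^sub>q\<close> is \<open>g\<^sub>q(x) - \<partial>\<^sup>- a\<^sub>1\<close>, and on the terms of \<open>\<partial>\<^sup>- a\<^sub>1\<close> the chain \<open>g\<^sub>q(x)\<close>
  agrees with \<open>x\<^sub>q\<^sup>-\<close>. A repeated term of \<open>x\<^sub>q\<^sub>+\<^sub>1\<close> would give a repeated term of \<open>g\<^sub>q(x)\<close> because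
  \<open>\<partial>\<^sup>- a \<noteq> 0\<close> by unitality.
\<close>

declare part.simps [simp del]

section \<open>Signed boundaries and their coefficients\<close>

abbreviation bdb :: "'a adc \<Rightarrow> sign \<Rightarrow> nat \<Rightarrow> 'a \<Rightarrow> ('a \<Rightarrow>\<^sub>0 int)"
  where "bdb K \<alpha> q a \<equiv> bdp K \<alpha> q (frag_of a)"

abbreviation bd_terms :: "'a adc \<Rightarrow> sign \<Rightarrow> nat \<Rightarrow> ('a \<Rightarrow>\<^sub>0 int) \<Rightarrow> ('a \<Rightarrow>\<^sub>0 int)"
  where "bd_terms K \<alpha> q \<equiv> frag_extend (bdb K \<alpha> q)"

text \<open>The induction alters one chain at a time, so the rest of the double sequence is
  forgotten and may change from step to step.\<close>

definition is_component :: "'a adc \<Rightarrow> nat \<Rightarrow> ('a \<Rightarrow>\<^sub>0 int) \<Rightarrow> bool"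
  where "is_component K q u \<longleftrightarrow> (\<exists>x \<in> nu K. \<exists>\<alpha>. u = x q \<alpha>)"

lemma lookup_frag_extend:
  "Poly_Mapping.lookup (frag_extend f c) b =
    (\<Sum>a \<in> Poly_Mapping.keys c. Poly_Mapping.lookup c a * Poly_Mapping.lookup (f a) b)"
  by (simp add: frag_extend_def lookup_sum)

lemma lookup_bdp_nonneg: "0 \<le> Poly_Mapping.lookup (bdp K \<alpha> q c) b"
  by (simp add: bdp_def lookup_part split: sign.split)

lemma sum_of_distinct_basis_leD:
  "sum_of_distinct_basis K q c \<Longrightarrow> Poly_Mapping.lookup c b \<le> 1"
  unfolding sum_of_distinct_basis_def by (metis insertE le_numeral_extra(4) singletonD zero_le_one)

text \<open>Signed boundaries have no negative coefficients, so the contribution of one term is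
  never cancelled by the others.\<close>

lemma mem_bd_terms_ge:
  assumes "\<And>b. 0 \<le> Poly_Mapping.lookup c b" and "a \<in> Poly_Mapping.keys c"
  shows "Poly_Mapping.lookup c a * Poly_Mapping.lookup (bdb K \<alpha> q a) b
    \<le> Poly_Mapping.lookup (bd_terms K \<alpha> q c) b"
  unfolding lookup_frag_extend
  by (rule member_le_sum[where f = "\<lambda>a. Poly_Mapping.lookup c a * Poly_Mapping.lookup (bdb K \<alpha> q a) b"])
    (simp_all add: assms lookup_bdp_nonneg)

context free_adc
begin

section \<open>Additivity of boundary and augmentation; consequences of unitality\<close>

lemma bd_closed:
  "c \<in> carrier (chain_group K (Suc q)) \<Longrightarrow> bd K (Suc q) c \<in> carrier (chain_group K q)"
  using hom_in_carrier[OF bd_hom] .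

lemma bd_add:
  assumes "a \<in> carrier (chain_group K (Suc q))" "b \<in> carrier (chain_group K (Suc q))"
  shows "bd K (Suc q) (a + b) = bd K (Suc q) a + bd K (Suc q) b"
  using hom_mult[OF bd_hom[of q], of a b] assms by simp

lemma bd_zero: "bd K q 0 = 0"
  using bd_0[of 0] bd_diff[of 0 _ 0] by (cases q) auto

lemma aug_add:
  assumes "a \<in> carrier (chain_group K 0)" "b \<in> carrier (chain_group K 0)"
  shows "aug K (a + b) = aug K a + aug K b"
  using hom_mult[OF aug_hom, of a b] assms by simp

lemma aug_zero: "aug K 0 = 0"
  using aug_add[of 0 0] by simp

lemma aug_diff:
  assumes "a \<in> carrier (chain_group K 0)" "b \<in> carrier (chain_group K 0)"
  shows "aug K (a - b) = aug K a - aug K b"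
proof -
  have "a - b \<in> carrier (chain_group K 0)"
    using assms keys_diff[of a b] by auto
  then show ?thesis
    using aug_add[of "a - b" b] assms by simp
qed

lemma bdb_closed:
  assumes "a \<in> basis K (Suc q)"
  shows "bdb K \<alpha> (Suc q) a \<in> carrier (chain_group K q)"
proof -
  have "Poly_Mapping.keys (bdb K \<alpha> (Suc q) a) \<subseteq> Poly_Mapping.keys (bd K (Suc q) (frag_of a))"
    by (auto simp: bdp_def in_keys_iff lookup_part split: sign.splits)
  then show ?thesis
    using bd_closed[of "frag_of a" q] assms by auto
qed

lemma bd_terms_closed:
  assumes "c \<in> carrier (chain_group K (Suc q))"
  shows "bd_terms K \<alpha> (Suc q) c \<in> carrier (chain_group K q)"
proof -
  have "Poly_Mapping.keys (bd_terms K \<alpha> (Suc q) c) \<subseteq>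
      (\<Union>a \<in> Poly_Mapping.keys c. Poly_Mapping.keys (bdb K \<alpha> (Suc q) a))"
    by (rule keys_frag_extend)
  then show ?thesis
    using assms bdb_closed[of _ q \<alpha>] by fastforce
qed

text \<open>The two sums may have terms in common, so they need not be the signed parts of the
  boundary of \<open>c\<close>.\<close>

lemma bd_eq_bd_terms:
  assumes "c \<in> carrier (chain_group K (Suc q))"
  shows "bd K (Suc q) c = bd_terms K Pos (Suc q) c - bd_terms K Neg (Suc q) c"
proof -
  have "bd K (Suc q) c = frag_extend (\<lambda>a. bdb K Pos (Suc q) a - bdb K Neg (Suc q) a) c"
    using bd_eq_frag_extend[OF assms] by (simp add: bdp_def part_diff)
  then show ?thesis
    by (intro poly_mapping_eqI)
      (simp add: lookup_minus lookup_frag_extend right_diff_distrib sum_subtractf)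
qed

text \<open>Unitality in dimension 0 gives every basis element augmentation 1, and both sides are
  additive.\<close>

lemma aug_eq_sum:
  assumes "unital K" and "c \<in> carrier (chain_group K 0)"
  shows "aug K c = (\<Sum>a \<in> Poly_Mapping.keys c. Poly_Mapping.lookup c a)"
proof -
  have basis: "aug K (frag_of a) = 1" if "a \<in> basis K 0" for a
    using assms(1) that unfolding unital_def by (metis bdp_iter.simps(1))
  \<comment> \<open>Seen as an extension into the free group on one generator, the coefficient sum
    is additive without any comparison of the keys of different chains.\<close>
  have degree: "(\<Sum>a \<in> Poly_Mapping.keys c. Poly_Mapping.lookup c a) =
      Poly_Mapping.lookup (frag_extend (\<lambda>_. frag_of ()) c) ()" for c :: "'a \<Rightarrow>\<^sub>0 int"
    by (simp add: lookup_frag_extend)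
  have "Poly_Mapping.keys c \<subseteq> basis K 0" using assms(2) by simp
  then have "aug K c = Poly_Mapping.lookup (frag_extend (\<lambda>_. frag_of ()) c) ()"
  proof (rule free_Abelian_group_induct)
    fix x y
    assume "Poly_Mapping.keys x \<subseteq> basis K 0" "Poly_Mapping.keys y \<subseteq> basis K 0"
      "aug K x = Poly_Mapping.lookup (frag_extend (\<lambda>_. frag_of ()) x) ()"
      "aug K y = Poly_Mapping.lookup (frag_extend (\<lambda>_. frag_of ()) y) ()"
    then show "aug K (x - y) = Poly_Mapping.lookup (frag_extend (\<lambda>_. frag_of ()) (x - y)) ()"
      by (simp add: aug_diff frag_extend_diff lookup_minus)
  qed (simp_all add: basis aug_zero)
  then show ?thesis by (simp add: degree)
qed

lemma bdp_iter_eq_zero: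
  assumes "bdp K \<alpha> q c = 0"
  shows "bdp_iter K \<alpha> (Suc r) q c = 0"
proof (induction r)
  case (Suc r)
  have "part \<alpha> 0 = (0 :: 'a \<Rightarrow>\<^sub>0 int)"
    by (rule poly_mapping_eqI) (simp add: lookup_part split: sign.split)
  with Suc show ?case by (simp add: bdp_def bd_zero)
qed (simp add: assms)

text \<open>Otherwise all further iterates vanish too, and the last one has augmentation 0 instead
  of 1.\<close>

lemma bdb_nonzero:
  assumes "unital K" and "a \<in> basis K (Suc q)"
  shows "bdb K \<alpha> (Suc q) a \<noteq> 0"
proof
  assume "bdb K \<alpha> (Suc q) a = 0"
  then have "bdp_iter K \<alpha> (Suc q) (Suc q) (frag_of a) = 0"
    by (rule bdp_iter_eq_zero)
  moreover have "aug K (bdp_iter K \<alpha> (Suc q) (Suc q) (frag_of a)) = 1"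
    using assms unfolding unital_def by blast
  ultimately show False by (simp only: aug_zero)
qed

section \<open>Ordering the terms of a chain by loop-freeness\<close>

lemma exists_minimal_term:
  assumes "loop_free K" and c: "c \<in> carrier (chain_group K (Suc q))" and "c \<noteq> 0"
  obtains a where "a \<in> Poly_Mapping.keys c"
    and "\<And>a'. a' \<in> Poly_Mapping.keys c \<Longrightarrow>
      Poly_Mapping.keys (bdb K Pos (Suc q) a') \<inter> Poly_Mapping.keys (bdb K Neg (Suc q) a) = {}"
proof -
  obtain R where R: "partial_order_on (SIGMA q:UNIV. basis K q) R"
    and prec: "\<forall>q. \<forall>a \<in> basis K q. \<forall>r > 0.
      \<forall>b \<in> Poly_Mapping.keys (bdp_iter K Neg r q (frag_of a)).
      \<forall>c \<in> Poly_Mapping.keys (bdp_iter K Pos r q (frag_of a)).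
        ((q - r, b), (q - r, c)) \<in> R \<and> b \<noteq> c"
    using assms(1) unfolding loop_free_def by (elim exE conjE) (rule that)
  define lt where "lt b d \<longleftrightarrow> ((q, b), (q, d)) \<in> R \<and> b \<noteq> d" for b d
  have lt_trans: "lt b e" if "lt b d" "lt d e" for b d e
    using partial_order_onD(2,3)[OF R] that unfolding lt_def
    by (blast dest: transD antisymD)
  have bdb_lt: "lt b d" if "a \<in> basis K (Suc q)" "b \<in> Poly_Mapping.keys (bdb K Neg (Suc q) a)"
    "d \<in> Poly_Mapping.keys (bdb K Pos (Suc q) a)" for a b d
    using prec[rule_format, of a "Suc q" 1 b d] that by (simp add: lt_def)
  \<comment> \<open>Having a common term need not be transitive; this weaker relation is. If
    \<open>d\<close> is a term of both \<open>bdb K Pos (Suc q) a'\<close> and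
    \<open>bdb K Neg (Suc q) a\<close>, loop-freeness with r = 1 puts all terms of
    \<open>bdb K Neg (Suc q) a'\<close> before \<open>d\<close>, so \<open>below a' a\<close>. Hence
    an \<open>a\<close> minimal for \<open>below\<close> is as required.\<close>
  define below where "below a' a \<longleftrightarrow>
    (\<exists>d \<in> Poly_Mapping.keys (bdb K Neg (Suc q) a).
      \<forall>b \<in> Poly_Mapping.keys (bdb K Neg (Suc q) a'). lt b d)" for a' a
  have below_irrefl: "\<not> below a a" for a
    unfolding below_def lt_def by blast
  have below_trans: "below a a''" if "below a a'" "below a' a''" for a a' a''
    using that lt_trans unfolding below_def by blast
  have "Poly_Mapping.keys c \<noteq> {}" using assms(3) by simp
  moreover have "asymp_on (Poly_Mapping.keys c) below"
    using below_irrefl below_trans by (intro asymp_onI) blast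
  moreover have "transp_on (Poly_Mapping.keys c) below"
    using below_trans by (intro transp_onI) blast
  ultimately obtain a where a: "a \<in> Poly_Mapping.keys c"
    and min: "\<And>a'. a' \<in> Poly_Mapping.keys c \<Longrightarrow> \<not> below a' a"
    using Finite_Set.bex_min_element[of "Poly_Mapping.keys c" below] below_irrefl
    by (metis finite_keys)
  show thesis
  proof (rule that[OF a])
    fix a' assume a': "a' \<in> Poly_Mapping.keys c"
    then have "a' \<in> basis K (Suc q)" using c by auto
    then show "Poly_Mapping.keys (bdb K Pos (Suc q) a') \<inter>
        Poly_Mapping.keys (bdb K Neg (Suc q) a) = {}"
      using min[OF a'] bdb_lt unfolding below_def by blast
  qed
qed

section \<open>Replacing a component by a homologous chain\<close>

text \<open>Adding a boundary changes neither the boundary of \<open>u\<close> nor, for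
  \<open>q = 0\<close>, its augmentation. So \<open>w\<close> can be the top chain of a member
  truncated at dimension \<open>q\<close>.\<close>

lemma is_component_homologous:
  assumes "is_component K q u" and w: "sum_of_basis K q w"
    and c: "c \<in> carrier (chain_group K (Suc q))" and wu: "w = u + bd K (Suc q) c"
  shows "is_component K q w"
proof -
  obtain x \<alpha> where x: "x \<in> nu K" and u: "u = x q \<alpha>"
    using assms(1) unfolding is_component_def by blast
  \<comment> \<open>Both signs carry \<open>w\<close> in dimension \<open>q\<close>, so the zero
    chains above it satisfy the boundary condition: \<open>w - w = 0\<close>.\<close>
  define y where "y p \<beta> = (if p < q then x p \<beta> else if p = q then w else 0)" for p and \<beta> :: sign
  have u_closed: "u \<in> carrier (chain_group K q)"
    using x u by (auto simp: nu_def sum_of_basis_def)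
  have "sum_of_basis K p (y p \<beta>)" for p \<beta>
    using x w by (auto simp: y_def nu_def sum_of_basis_def)
  moreover have "(p, \<beta>) \<in> {..q} \<times> {Neg, Pos}" if "y p \<beta> \<noteq> 0" for p \<beta>
    using that by (cases \<beta>) (auto simp: y_def split: if_splits)
  then have "finite {(p, \<beta>). y p \<beta> \<noteq> 0}"
    using finite_subset[of "{(p, \<beta>). y p \<beta> \<noteq> 0}" "{..q} \<times> {Neg, Pos}"] by auto
  moreover have "aug K (y 0 \<beta>) = 1" for \<beta>
  proof (cases q)
    case 0
    have "aug K w = aug K u + aug K (bd K 1 c)"
      using aug_add[of u "bd K (Suc q) c"] u_closed bd_closed[OF c] wu 0 by simp
    then show ?thesis
      using aug_bd[of c] c 0 x u by (simp add: y_def nu_def)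
  next
    case (Suc p)
    then show ?thesis using x by (simp add: y_def nu_def)
  qed
  moreover have "bd K p (y p \<beta>) = y (p - 1) Pos - y (p - 1) Neg" if "p > 0" for p \<beta>
  proof (cases "p = q")
    case True
    obtain p' where p': "q = Suc p'" using \<open>p > 0\<close> True by (cases q) auto
    have "bd K q w = bd K q u + bd K q (bd K (Suc q) c)"
      using bd_add[of u p' "bd K (Suc q) c"] u_closed bd_closed[OF c] wu p' by simp
    also have "\<dots> = x (q - 1) Pos - x (q - 1) Neg"
      using x u c bd_bd[of c p'] p' by (simp add: nu_def)
    finally show ?thesis using True p' by (simp add: y_def)
  next
    case False
    have "bd K p (x p \<beta>) = x (p - 1) Pos - x (p - 1) Neg"
      using x \<open>p > 0\<close> unfolding nu_def by blast
    moreover have "p - 1 < q" if "p < q" using that by linarith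
    moreover have "\<not> p - 1 < q" if "\<not> p < q" using that False by linarith
    ultimately show ?thesis
      using False by (cases "p < q") (simp_all add: y_def bd_zero)
  qed
  ultimately have "y \<in> nu K" unfolding nu_def by blast
  moreover have "w = y q Neg" by (simp add: y_def)
  ultimately show ?thesis unfolding is_component_def by blast
qed

section \<open>Distinct terms in the chains g\<close>

text \<open>For \<open>u = x q Neg\<close> and \<open>c = x (Suc q) \<alpha>\<close> the resulting
  chain is \<open>gchain K \<alpha> q x\<close>, and \<open>u + bd K (Suc q) c\<close> is
  \<open>x q Pos\<close>. Stated without \<open>x\<close>, the claim lets the induction change
  \<open>u\<close> and \<open>c\<close> together.\<close>

lemma component_add_bd_terms_distinct:
  assumes "loop_free K"
    and distinct: "\<And>u. is_component K q u \<Longrightarrow> sum_of_distinct_basis K q u"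
  shows "\<lbrakk>is_component K q u; sum_of_basis K (Suc q) c; sum_of_basis K q (u + bd K (Suc q) c)\<rbrakk>
    \<Longrightarrow> sum_of_distinct_basis K q (u + bd_terms K Pos (Suc q) c)"
\<comment> \<open>Terms are counted with multiplicity, since \<open>c\<close> may still have
  repeated terms and only one copy is removed at a time.\<close>
proof (induction "nat (\<Sum>a \<in> Poly_Mapping.keys c. Poly_Mapping.lookup c a)"
    arbitrary: c u rule: less_induct)
  case less
  note u = less.prems(1)
  have c: "c \<in> carrier (chain_group K (Suc q))"
    and c_nonneg: "0 \<le> Poly_Mapping.lookup c a" for a
    using less.prems(2) by (auto simp: sum_of_basis_def)
  show ?case
  proof (cases "c = 0")
    case True
    then show ?thesis using distinct[OF u] by simp
  next
    case False
    obtain a where a: "a \<in> Poly_Mapping.keys c"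
      and disj: "\<And>a'. a' \<in> Poly_Mapping.keys c \<Longrightarrow>
        Poly_Mapping.keys (bdb K Pos (Suc q) a') \<inter> Poly_Mapping.keys (bdb K Neg (Suc q) a) = {}"
      using exists_minimal_term[OF assms(1) c False] by blast
    let ?P = "bd_terms K Pos (Suc q) c" and ?m = "bdb K Neg (Suc q) a" and ?p = "bdb K Pos (Suc q) a"
    have a_basis: "a \<in> basis K (Suc q)" using a c by auto
    then have a_closed: "frag_of a \<in> carrier (chain_group K (Suc q))" by simp
    have c_a: "1 \<le> Poly_Mapping.lookup c a"
      using a c_nonneg[of a] by (simp add: in_keys_iff)
    have P_zero: "Poly_Mapping.lookup ?P b = 0" if "Poly_Mapping.lookup ?m b \<noteq> 0" for b
      unfolding lookup_frag_extend
    proof (rule sum.neutral, intro ballI)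
      fix a' assume "a' \<in> Poly_Mapping.keys c"
      then have "Poly_Mapping.lookup (bdb K Pos (Suc q) a') b = 0"
        using disj that by (metis disjoint_iff in_keys_iff)
      then show "Poly_Mapping.lookup c a' * Poly_Mapping.lookup (bdb K Pos (Suc q) a') b = 0"
        by simp
    qed
    have u_basis: "sum_of_distinct_basis K q u" using distinct[OF u] .
    then have u_closed: "u \<in> carrier (chain_group K q)"
      and u_nonneg: "0 \<le> Poly_Mapping.lookup u b" for b
      by (simp add: sum_of_distinct_basis_def)
        (use u_basis in \<open>metis empty_iff insertE order_refl sum_of_distinct_basis_def zero_le_one\<close>)
    \<comment> \<open>Nonnegativity of \<open>u + bd K (Suc q) c\<close> bounds the negative terms
      of \<open>c\<close> by \<open>u + ?P\<close>, and \<open>?P\<close> vanishes on the terms of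
      \<open>?m\<close> by the choice of \<open>a\<close>.\<close>
    have m_le_u: "Poly_Mapping.lookup ?m b \<le> Poly_Mapping.lookup u b" for b
    proof (cases "Poly_Mapping.lookup ?m b = 0")
      case True
      then show ?thesis using u_nonneg by simp
    next
      case False
      have "Poly_Mapping.lookup ?m b \<le> Poly_Mapping.lookup c a * Poly_Mapping.lookup ?m b"
        using c_a lookup_bdp_nonneg[of K Neg "Suc q" "frag_of a" b] by (simp add: mult_le_cancel_right1)
      also have "\<dots> \<le> Poly_Mapping.lookup (bd_terms K Neg (Suc q) c) b"
        by (rule mem_bd_terms_ge[OF c_nonneg a])
      also have "\<dots> \<le> Poly_Mapping.lookup u b + Poly_Mapping.lookup ?P b"
        using less.prems(3) unfolding sum_of_basis_def bd_eq_bd_terms[OF c]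
        by (smt (verit) lookup_add lookup_minus)
      finally show ?thesis using P_zero[OF False] by simp
    qed
    define w where "w = u + bd K (Suc q) (frag_of a)"
    define c' where "c' = c - frag_of a"
    have bd_a: "bd K (Suc q) (frag_of a) = ?p - ?m"
      by (simp add: bdp_def part_diff)
    have w_closed: "w \<in> carrier (chain_group K q)"
      using keys_add[of u "bd K (Suc q) (frag_of a)"] u_closed bd_closed[OF a_closed]
      unfolding w_def by auto
    have "0 \<le> Poly_Mapping.lookup w b" for b
      using m_le_u[of b] lookup_bdp_nonneg[of K Pos "Suc q" "frag_of a" b]
      by (simp add: w_def bd_a lookup_add lookup_minus)
    then have "sum_of_basis K q w" using w_closed by (simp add: sum_of_basis_def)
    then have w: "is_component K q w"
      using is_component_homologous[OF u _ a_closed w_def] by blast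
    have c'_closed: "c' \<in> carrier (chain_group K (Suc q))"
      using keys_diff[of c "frag_of a"] c a_basis unfolding c'_def by auto
    have c': "sum_of_basis K (Suc q) c'"
      using c'_closed c_a c_nonneg
      by (auto simp: sum_of_basis_def c'_def lookup_minus)
    \<comment> \<open>The end point is unchanged, so its nonnegativity carries over to the shorter
      chain.\<close>
    have "w + bd K (Suc q) c' = u + bd K (Suc q) c"
      using bd_diff[OF c a_closed] by (simp add: w_def c'_def)
    then have w_c': "sum_of_basis K q (w + bd K (Suc q) c')"
      using less.prems(3) by simp
    have "Poly_Mapping.keys c' \<subseteq> Poly_Mapping.keys c"
      using keys_diff[of c "frag_of a"] a unfolding c'_def by auto
    then have "(\<Sum>b \<in> Poly_Mapping.keys c'. Poly_Mapping.lookup c' b) =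
        (\<Sum>b \<in> Poly_Mapping.keys c. Poly_Mapping.lookup c' b)"
      by (intro sum.mono_neutral_left) (auto simp: in_keys_iff)
    also have "\<dots> = (\<Sum>b \<in> Poly_Mapping.keys c. Poly_Mapping.lookup c b) - 1"
      using a by (simp add: c'_def lookup_minus sum_subtractf)
    finally have "(\<Sum>b \<in> Poly_Mapping.keys c'. Poly_Mapping.lookup c' b) =
        (\<Sum>b \<in> Poly_Mapping.keys c. Poly_Mapping.lookup c b) - 1" .
    \<comment> \<open>As \<open>nat\<close> truncates at 0, this is needed for a strict decrease of
      the measure.\<close>
    moreover have "0 \<le> (\<Sum>b \<in> Poly_Mapping.keys c'. Poly_Mapping.lookup c' b)"
      using c' by (intro sum_nonneg) (simp add: sum_of_basis_def)
    ultimately have IH: "sum_of_distinct_basis K q (w + bd_terms K Pos (Suc q) c')"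
      using less.hyps[OF _ w c' w_c'] by simp
    have eq: "w + bd_terms K Pos (Suc q) c' = u + ?P - ?m"
      by (simp add: w_def c'_def bd_a frag_extend_diff)
    have "Poly_Mapping.lookup (u + ?P) b \<in> {0, 1}" for b
    proof (cases "Poly_Mapping.lookup ?m b = 0")
      case True
      then have "Poly_Mapping.lookup (u + ?P) b = Poly_Mapping.lookup (u + ?P - ?m) b"
        by (simp add: lookup_minus)
      then show ?thesis using IH unfolding eq sum_of_distinct_basis_def by metis
    next
      case False
      then show ?thesis
        using P_zero u_basis unfolding sum_of_distinct_basis_def lookup_add by (metis add.right_neutral)
    qed
    moreover have "u + ?P \<in> carrier (chain_group K q)"
      using keys_add[of u ?P] u_closed bd_terms_closed[OF c, of Pos] by auto
    ultimately show ?thesis unfolding sum_of_distinct_basis_def by blast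
  qed
qed

lemma gchain_distinct:
  assumes "loop_free K" and "x \<in> nu K"
    and "\<And>u. is_component K q u \<Longrightarrow> sum_of_distinct_basis K q u"
  shows "sum_of_distinct_basis K q (gchain K \<alpha> q x)"
proof -
  have "bd K (Suc q) (x (Suc q) \<alpha>) = x q Pos - x q Neg"
    using assms(2) unfolding nu_def by force
  moreover have "sum_of_basis K (Suc q) (x (Suc q) \<alpha>)" "sum_of_basis K q (x q Pos)"
    using assms(2) unfolding nu_def by auto
  moreover have "is_component K q (x q Neg)"
    using assms(2) unfolding is_component_def by blast
  ultimately show ?thesis
    using component_add_bd_terms_distinct[OF assms(1,3), of "x q Neg" "x (Suc q) \<alpha>"]
    by (simp add: gchain_def)
qed

section \<open>Dimension 0 and the induction on dimension\<close>

text \<open>Nonnegative integer coefficients with sum 1, the augmentation, leave room for a single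
  term.\<close>

lemma component_zero_basis:
  assumes "unital K" and "x \<in> nu K"
  shows "\<exists>a \<in> basis K 0. x 0 \<alpha> = frag_of a"
proof -
  let ?c = "x 0 \<alpha>"
  have c: "?c \<in> carrier (chain_group K 0)" and nonneg: "0 \<le> Poly_Mapping.lookup ?c a"
    and sum: "(\<Sum>a \<in> Poly_Mapping.keys ?c. Poly_Mapping.lookup ?c a) = 1" for a
    using assms(2) aug_eq_sum[OF assms(1), of ?c] by (auto simp: nu_def sum_of_basis_def)
  have "Poly_Mapping.keys ?c \<noteq> {}"
    using sum by (metis sum.empty zero_neq_one)
  then obtain a where a: "a \<in> Poly_Mapping.keys ?c" by blast
  have ge: "1 \<le> Poly_Mapping.lookup ?c b" if "b \<in> Poly_Mapping.keys ?c" for b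
    using that nonneg[of b] by (simp add: in_keys_iff)
  have "Poly_Mapping.lookup ?c b = Poly_Mapping.lookup (frag_of a) b" for b
  proof -
    have split: "1 = Poly_Mapping.lookup ?c a +
        (\<Sum>b \<in> Poly_Mapping.keys ?c - {a}. Poly_Mapping.lookup ?c b)"
      using sum a by (simp add: sum.remove)
    moreover have rest: "0 \<le> (\<Sum>b \<in> Poly_Mapping.keys ?c - {a}. Poly_Mapping.lookup ?c b)"
      by (rule sum_nonneg) (rule nonneg)
    ultimately have "Poly_Mapping.lookup ?c a = 1"
      and "(\<Sum>b \<in> Poly_Mapping.keys ?c - {a}. Poly_Mapping.lookup ?c b) = 0"
      using ge[OF a] by linarith+
    then have "\<forall>b \<in> Poly_Mapping.keys ?c - {a}. Poly_Mapping.lookup ?c b = 0"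
      using nonneg by (subst (asm) sum_nonneg_eq_0_iff) auto
    then have "Poly_Mapping.lookup ?c b = 0" if "b \<noteq> a"
      using that by (auto simp: in_keys_iff)
    then show ?thesis
      using \<open>Poly_Mapping.lookup ?c a = 1\<close> by auto
  qed
  then have "?c = frag_of a" by (rule poly_mapping_eqI)
  moreover have "a \<in> basis K 0" using a c by auto
  ultimately show ?thesis by blast
qed

lemma component_distinct:
  assumes "unital K" and "loop_free K"
  shows "is_component K q u \<Longrightarrow> sum_of_distinct_basis K q u"
proof (induction q arbitrary: u)
  case 0
  then obtain a where "a \<in> basis K 0" "u = frag_of a"
    using component_zero_basis[OF assms(1)] unfolding is_component_def by blast
  then show ?case by (simp add: sum_of_distinct_basis_def)
next
  case (Suc q)
  then obtain x \<alpha> where x: "x \<in> nu K" and u: "u = x (Suc q) \<alpha>"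
    unfolding is_component_def by blast
  have closed: "u \<in> carrier (chain_group K (Suc q))"
    and nonneg: "0 \<le> Poly_Mapping.lookup u a" and pos: "0 \<le> Poly_Mapping.lookup (x q Pos) a" for a
    using x u by (auto simp: nu_def sum_of_basis_def)
  have g: "sum_of_distinct_basis K q (gchain K \<alpha> q x)"
    using gchain_distinct[OF assms(2) x Suc.IH] .
  have "Poly_Mapping.lookup u a \<le> 1" if a: "a \<in> Poly_Mapping.keys u" for a
  proof -
    let ?m = "bdb K Neg (Suc q) a"
    have "a \<in> basis K (Suc q)" using a closed by auto
    then obtain b where "Poly_Mapping.lookup ?m b \<noteq> 0"
      using bdb_nonzero[OF assms(1)] by (metis lookup_zero poly_mapping_eqI)
    then have "1 \<le> Poly_Mapping.lookup ?m b"
      using lookup_bdp_nonneg[of K Neg "Suc q" "frag_of a" b] by linarith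
    then have "Poly_Mapping.lookup u a \<le> Poly_Mapping.lookup u a * Poly_Mapping.lookup ?m b"
      using nonneg[of a] by (simp add: mult_le_cancel_left1)
    also have "\<dots> \<le> Poly_Mapping.lookup (bd_terms K Neg (Suc q) u) b"
      by (rule mem_bd_terms_ge[OF nonneg a])
    \<comment> \<open>The second expression for g is used here: it is the sum of the negative
      boundaries plus the nonnegative chain \<open>x q Pos\<close>.\<close>
    also have "\<dots> \<le> Poly_Mapping.lookup (gchain K \<alpha> q x) b"
      using pos[of b] by (simp add: gchain_alt[OF x] u lookup_add)
    also have "\<dots> \<le> 1" by (rule sum_of_distinct_basis_leD[OF g])
    finally show ?thesis .
  qed
  then have "Poly_Mapping.lookup u a \<in> {0, 1}" for a
    using nonneg[of a] by (cases "a \<in> Poly_Mapping.keys u") (force simp: in_keys_iff)+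
  then show ?case using closed by (simp add: sum_of_distinct_basis_def)
qed

end

theorem theorem4p1:
  fixes K :: "'a adc"
  assumes "free_adc K" and "unital K" and "loop_free K"
  shows "(\<forall>x \<in> nu K. \<forall>\<alpha>. \<exists>a \<in> basis K 0. x 0 \<alpha> = frag_of a) \<and>
    (\<forall>x \<in> nu K. \<forall>q. \<forall>c \<in> {x q Neg, x q Pos, gchain K Neg q x, gchain K Pos q x}.
      sum_of_distinct_basis K q c)"
proof -
  interpret free_adc K by fact
  have "sum_of_distinct_basis K q (x q \<alpha>)" if "x \<in> nu K" for x q \<alpha>
    using component_distinct[OF assms(2,3)] that unfolding is_component_def by blast
  moreover have "sum_of_distinct_basis K q (gchain K \<alpha> q x)" if "x \<in> nu K" for x q \<alpha>
    using gchain_distinct[OF assms(3) that component_distinct[OF assms(2,3)]] .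
  ultimately show ?thesis
    using component_zero_basis[OF assms(2)] by blast
qed

end
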